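(* Let $N = q^k n^2$ be an odd perfect number given in Eulerian form. Define $H = \gcd(n^2,\sigma(n^2))$, $I = \gcd(n,\sigma(n^2))$ and $J = H/I$. Then each of the following conditions is equivalent to $J = 1$: (1) $n$ divides $\sigma(q^k)/2$; (2) $\sigma(n^2)$ divides $q^k n$.
   Context: $\sigma(x)$ denotes the sum of the positive divisors of $x$. A positive integer $N$ is perfect if $\sigma(N)=2N$. An odd perfect number $N$ is said to be given in Eulerian form $N = q^k n^2$ if $q$ is a prime (the special prime), $k$ and $n$ are positive integers, $q \equiv k \equiv 1 \pmod 4$, and $\gcd(q,n)=1$. *)

theory Defs
  imports "HOL-Number_Theory.Number_Theory"
begin

definition divisor_sum :: "nat \<Rightarrow> nat"
  where "divisor_sum x = (\<Sum>d | d dvd x. d)"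

definition perfect :: "nat \<Rightarrow> bool"
  where "perfect N \<longleftrightarrow> N > 0 \<and> divisor_sum N = 2 * N"

definition eulerian_form :: "nat \<Rightarrow> nat \<Rightarrow> nat \<Rightarrow> nat \<Rightarrow> bool"
  where "eulerian_form N q k n \<longleftrightarrow>
    N = q ^ k * n\<^sup>2 \<and> prime q \<and> k > 0 \<and> n > 0 \<and>
    [q = k] (mod 4) \<and> [k = 1] (mod 4) \<and> gcd q n = 1"

text \<open>
  The next two facts show that, for an Eulerian form, truncating division on natural numbers is
  exact in \<open>gcd (n\<^sup>2) s div gcd n s\<close> and in \<open>divisor_sum (q ^ k) div 2\<close>.
\<close>

lemma gcd_dvd_gcd_square: "gcd n s dvd gcd (n\<^sup>2) s" for n s :: nat
  by (metis dvd_refl dvd_triv_left gcd_mono power2_eq_square)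

lemma even_divisor_sum_prime_power:
  assumes "eulerian_form N q k n"
  shows "even (divisor_sum (q ^ k))"
proof -
  have q: "prime q" and qk: "[q = k] (mod 4)" and k: "[k = 1] (mod 4)"
    using assms by (auto simp: eulerian_form_def)
  have "q mod 4 = 1" "k mod 4 = 1"
    using qk k by (auto simp: cong_def)
  then have odd: "odd q" "odd k"
    by presburger+
  have "divisor_sum (q ^ k) = (\<Sum>d\<in>(\<lambda>i. q ^ i) ` {..k}. d)"
    unfolding divisor_sum_def using q
    by (intro sum.cong) (auto simp: divides_primepow_nat)
  also have "\<dots> = (\<Sum>i\<le>k. q ^ i)"
    using q prime_gt_1_nat by (subst sum.reindex) (auto simp: inj_on_def)
  finally have "even (divisor_sum (q ^ k)) \<longleftrightarrow> even (card {i \<in> {..k}. odd (q ^ i)})"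
    by (simp add: even_sum_iff)
  also have "{i \<in> {..k}. odd (q ^ i)} = {..k}"
    using odd by auto
  finally show ?thesis
    using odd by simp
qed

end

theory Submission
  imports Defs
begin

text \<open>
  Put \<open>A = \<sigma>(q^k) / 2\<close>. Multiplicativity of \<open>\<sigma>\<close> turns perfection into \<open>A \<sigma>(n^2) = q^k n^2\<close>, and
  \<open>q\<close> does not divide \<open>\<sigma>(q^k)\<close>, so \<open>\<sigma>(n^2) = q^k T\<close> with \<open>A T = n^2\<close>. Then \<open>H = T\<close> and
  \<open>I = gcd n T\<close>, and all three conditions say that \<open>T\<close> divides \<open>n\<close>.
\<close>

text \<open>Multiplying a divisor of \<open>a\<close> by a divisor of \<open>b\<close> is a
  bijection onto the divisors of \<open>a * b\<close>, so the sum factors as a product. Coprimality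
  is what makes it injective.\<close>

lemma divisor_sum_mult_coprime:
  assumes "coprime a b"
  shows "divisor_sum (a * b) = divisor_sum a * divisor_sum b"
proof -
  have inj: "inj_on (\<lambda>(d, e). d * e) ({d. d dvd a} \<times> {e. e dvd b})"
  proof (rule inj_onI, clarsimp)
    fix d e d' e'
    assume "d dvd a" "e dvd b" "d' dvd a" "e' dvd b" and eq: "d * e = d' * e'"
    then have "coprime d e'" "coprime d' e"
      using assms by (meson coprime_divisors)+
    then show "d = d' \<and> e = e'"
      using eq coprime_crossproduct_nat[of d e' d' e] by (simp add: mult.commute)
  qed
  have img: "(\<lambda>(d, e). d * e) ` ({d. d dvd a} \<times> {e. e dvd b}) = {d. d dvd a * b}"
    by (auto simp: image_iff mult_dvd_mono dest: division_decomp)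
  have "divisor_sum (a * b) = (\<Sum>(d, e)\<in>{d. d dvd a} \<times> {e. e dvd b}. d * e)"
    unfolding divisor_sum_def img[symmetric] sum.reindex[OF inj]
    by (simp add: case_prod_unfold)
  also have "\<dots> = divisor_sum a * divisor_sum b"
    unfolding divisor_sum_def by (simp add: sum_product sum.cartesian_product)
  finally show ?thesis .
qed

text \<open>Every divisor of \<open>q ^ k\<close> except 1 is a multiple of \<open>q\<close>, so the
  sum is 1 modulo \<open>q\<close>.\<close>

lemma coprime_divisor_sum_prime_power:
  assumes "prime q"
  shows "coprime q (divisor_sum (q ^ k))"
proof -
  have fin: "finite {d. d dvd q ^ k}"
    using assms by (simp add: prime_gt_0_nat)
  have "q dvd d" if "d dvd q ^ k" "d \<noteq> 1" for d
    using that assms by (auto simp: divides_primepow_nat intro: dvd_power)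
  then have "q dvd (\<Sum>d\<in>{d. d dvd q ^ k} - {1}. d)"
    by (intro dvd_sum) auto
  moreover have "divisor_sum (q ^ k) = 1 + (\<Sum>d\<in>{d. d dvd q ^ k} - {1}. d)"
    unfolding divisor_sum_def by (subst sum.remove[OF fin, of 1]) simp_all
  ultimately have "\<not> q dvd divisor_sum (q ^ k)"
    using assms by (metis dvd_add_left_iff not_prime_unit)
  then show ?thesis
    using assms by (simp add: prime_imp_coprime)
qed

theorem theorem1:
  fixes N q k n H I J :: nat
  assumes "odd N" and "perfect N" and "eulerian_form N q k n"
    and "H = gcd (n\<^sup>2) (divisor_sum (n\<^sup>2))"
    and "I = gcd n (divisor_sum (n\<^sup>2))"
    and "J = H div I"
  shows "(J = 1 \<longleftrightarrow> n dvd divisor_sum (q ^ k) div 2) \<and>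
    (J = 1 \<longleftrightarrow> divisor_sum (n\<^sup>2) dvd q ^ k * n)"
proof -
  have q: "prime q" and n: "n > 0" and qn: "coprime q n" and N: "N = q ^ k * n\<^sup>2"
    using assms(3) unfolding eulerian_form_def coprime_iff_gcd_eq_1 by blast+
  define A where "A = divisor_sum (q ^ k) div 2"
  have A: "divisor_sum (q ^ k) = 2 * A"
    using even_divisor_sum_prime_power[OF assms(3)] by (simp add: A_def)
  have "divisor_sum (q ^ k) * divisor_sum (n\<^sup>2) = 2 * (q ^ k * n\<^sup>2)"
    using assms(2) qn divisor_sum_mult_coprime[of "q ^ k" "n\<^sup>2"] by (simp add: perfect_def N)
  then have AS: "A * divisor_sum (n\<^sup>2) = q ^ k * n\<^sup>2"
    by (simp add: A)
  \<comment> \<open>\<open>A\<close> inherits coprimality to \<open>q\<close> from its multiple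
    \<open>2 * A\<close>.\<close>
  have cop: "coprime (q ^ k) A"
    using coprime_divisor_sum_prime_power[OF q, of k] by (simp add: A)
  have "q ^ k dvd divisor_sum (n\<^sup>2)"
    using AS cop by (metis coprime_dvd_mult_right_iff dvd_triv_left)
  then obtain T where T: "divisor_sum (n\<^sup>2) = q ^ k * T"
    by (elim dvdE)
  have AT: "A * T = n\<^sup>2"
    using AS q by (simp add: T prime_gt_0_nat)
  have T0: "T > 0"
    using AT n by (cases T) auto
  have "H = gcd (A * T) (q ^ k * T)"
    by (simp add: assms(4) T AT)
  \<comment> \<open>Pull out the common factor \<open>T\<close>; the cofactors \<open>A\<close> and
    \<open>q ^ k\<close> are coprime.\<close>
  also have "\<dots> = T"
    using cop by (metis coprime_commute coprime_imp_gcd_eq_1 gcd_mult_distrib_nat mult.commute mult_1_right)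
  finally have H: "H = T" .
  have I: "I = gcd n T"
    using qn by (simp add: assms(5) T gcd_mult_right_left_cancel coprime_commute)
  \<comment> \<open>The division \<open>T div gcd n T\<close> is exact, so a quotient of 1 means
    equality; \<open>T > 0\<close> excludes 0 div 0.\<close>
  have "J = 1 \<longleftrightarrow> T = gcd n T"
    unfolding assms(6) H I using T0
    by (metis div_self dvd_div_mult_self gcd_dvd2 mult_1 less_not_refl2)
  then have J: "J = 1 \<longleftrightarrow> T dvd n"
    by (metis gcd_dvd1 gcd_nat.absorb2)
  \<comment> \<open>Multiply both sides by \<open>T > 0\<close> and replace \<open>A * T\<close> by
    \<open>n * n\<close>; cancelling \<open>n\<close> then leaves \<open>T dvd n\<close>.\<close>
  have "n dvd A \<longleftrightarrow> n * T dvd n * n"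
    using T0 by (simp flip: power2_eq_square AT)
  also have "\<dots> \<longleftrightarrow> T dvd n"
    using n by simp
  finally have "n dvd A \<longleftrightarrow> T dvd n" .
  moreover have "divisor_sum (n\<^sup>2) dvd q ^ k * n \<longleftrightarrow> T dvd n"
    using q by (simp add: T prime_gt_0_nat)
  ultimately show ?thesis
    using J by (simp add: A_def)
qed

end
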